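(* Let $K\ge 2$ be an integer and let $M_K:[0,\infty)^K\to[0,\infty)$ be the arithmetic mean, $M_K(e_1,\dots,e_K):=(e_1+\dots+e_K)/K$. Then $M_K$ essentially dominates every symmetric e-merging function $F$; that is, for every symmetric e-merging function $F:[0,\infty)^K\to[0,\infty)$ and every $\mathbf{e}\in[0,\infty)^K$, if $F(\mathbf{e})>1$ then $M_K(\mathbf{e})\ge F(\mathbf{e})$.
   Context: For a probability space $(\Omega,\mathcal{A},Q)$, an e-variable is a measurable function $E:\Omega\to[0,\infty]$ with $\mathbb{E}^Q[E]\le 1$. An e-merging function (of $K$ e-values) is a Borel function $F:[0,\infty)^K\to[0,\infty)$ that is increasing ($\mathbf{e}\le\mathbf{e}'$ componentwise implies $F(\mathbf{e})\le F(\mathbf{e}')$) and such that, for every probability space $(\Omega,\mathcal{A},Q)$ and all e-variables $E_1,\dots,E_K$ on it taking values in $[0,\infty)$ (with arbitrary joint distribution), $F(E_1,\dots,E_K)$ is an e-variable. $F$ is symmetric if it is invariant under permutations of its arguments. An e-merging function $F$ essentially dominates an e-merging function $G$ if, for all $\mathbf{e}\in[0,\infty)^K$, $G(\mathbf{e})>1$ implies $F(\mathbf{e})\ge G(\mathbf{e})$. *)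

theory Defs
  imports "HOL-Probability.Probability"
begin

text \<open>Vectors of \<open>K\<close> e-values are elements of \<^typ>\<open>real ^ 'k\<close> with \<open>K = CARD('k)\<close>; functions on
  \<open>[0,\<infinity>)\<^sup>K\<close> are total functions on \<^typ>\<open>real ^ 'k\<close> of which only the values on the nonnegative
  orthant matter. The order on \<^typ>\<open>real ^ 'k\<close> is componentwise.\<close>

definition nonneg_orthant :: "(real ^ 'k) set" where
  "nonneg_orthant = {e. \<forall>k. 0 \<le> e $ k}"

definition e_variable :: "'w measure \<Rightarrow> ('w \<Rightarrow> ennreal) \<Rightarrow> bool" where
  "e_variable Q E \<longleftrightarrow> E \<in> borel_measurable Q \<and> (\<integral>\<^sup>+ \<omega>. E \<omega> \<partial>Q) \<le> 1"

definition preserves_e_variables :: "'w measure \<Rightarrow> (real ^ 'k \<Rightarrow> real) \<Rightarrow> bool" where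
  "preserves_e_variables Q F \<longleftrightarrow>
     (\<forall>E :: 'k \<Rightarrow> 'w \<Rightarrow> real.
        (\<forall>k. \<forall>\<omega> \<in> space Q. 0 \<le> E k \<omega>) \<and> (\<forall>k. e_variable Q (\<lambda>\<omega>. ennreal (E k \<omega>))) \<longrightarrow>
        e_variable Q (\<lambda>\<omega>. ennreal (F (\<chi> k. E k \<omega>))))"

text \<open>A definition in HOL cannot quantify over the type of sample points, so the probability
  spaces below are all those whose sample points have type \<^typ>\<open>real ^ 'k\<close>. This is no restriction,
  since the joint law of \<open>K\<close> e-variables lives on this type: see \<open>e_merging_any_space\<close>.\<close>

definition e_merging :: "(real ^ 'k \<Rightarrow> real) \<Rightarrow> bool" where
  "e_merging F \<longleftrightarrow>
     F \<in> borel_measurable (restrict_space borel nonneg_orthant) \<and>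
     (\<forall>e \<in> nonneg_orthant. 0 \<le> F e) \<and>
     mono_on nonneg_orthant F \<and>
     (\<forall>Q :: (real ^ 'k) measure. prob_space Q \<longrightarrow> preserves_e_variables Q F)"

definition symmetric_merging :: "(real ^ 'k \<Rightarrow> real) \<Rightarrow> bool" where
  "symmetric_merging F \<longleftrightarrow>
     (\<forall>p :: 'k \<Rightarrow> 'k. bij p \<longrightarrow> (\<forall>e \<in> nonneg_orthant. F (\<chi> k. e $ p k) = F e))"

definition essentially_dominates :: "(real ^ 'k \<Rightarrow> real) \<Rightarrow> (real ^ 'k \<Rightarrow> real) \<Rightarrow> bool" where
  "essentially_dominates F G \<longleftrightarrow> (\<forall>e \<in> nonneg_orthant. G e > 1 \<longrightarrow> F e \<ge> G e)"

definition arith_mean :: "real ^ 'k \<Rightarrow> real" where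
  "arith_mean e = (\<Sum>k\<in>UNIV. e $ k) / real CARD('k)"

lemma e_variable_real_measurable:
  assumes "\<forall>\<omega> \<in> space Q. 0 \<le> E \<omega>" and "e_variable Q (\<lambda>\<omega>. ennreal (E \<omega>))"
  shows "E \<in> borel_measurable Q"
proof -
  have "(\<lambda>\<omega>. enn2real (ennreal (E \<omega>))) \<in> borel_measurable Q"
    using assms(2) unfolding e_variable_def by (intro borel_measurable_enn2real) simp
  moreover have "enn2real (ennreal (E \<omega>)) = E \<omega>" if "\<omega> \<in> space Q" for \<omega>
    using assms(1) that by simp
  ultimately show ?thesis
    by (subst measurable_cong[where g = "\<lambda>\<omega>. enn2real (ennreal (E \<omega>))"]) auto
qed

lemma e_merging_any_space:
  fixes F :: "real ^ 'k \<Rightarrow> real" and Q :: "'w measure"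
  assumes F: "e_merging F" and Q: "prob_space Q"
  shows "preserves_e_variables Q F"
  unfolding preserves_e_variables_def
proof (intro allI impI, elim conjE)
  fix E :: "'k \<Rightarrow> 'w \<Rightarrow> real"
  assume nonneg: "\<forall>k. \<forall>\<omega> \<in> space Q. 0 \<le> E k \<omega>"
    and ev: "\<forall>k. e_variable Q (\<lambda>\<omega>. ennreal (E k \<omega>))"
  define V where "V = (\<lambda>\<omega>. \<chi> k. E k \<omega>)"
  define R where "R = restrict_space (borel :: (real ^ 'k) measure) nonneg_orthant"
  define D where "D = distr Q R V"
  have Em: "E k \<in> borel_measurable Q" for k
    using e_variable_real_measurable[of Q "E k"] nonneg ev by blast
  have "V \<in> borel_measurable Q"
    unfolding V_def
    by (subst borel_measurable_euclidean_space)
       (auto simp: Basis_vec_def inner_axis intro!: Em)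
  moreover have "V \<in> space Q \<rightarrow> nonneg_orthant"
    using nonneg by (auto simp: V_def nonneg_orthant_def)
  ultimately have V: "V \<in> measurable Q R"
    by (simp add: R_def measurable_restrict_space2)
  have Fm: "F \<in> borel_measurable R"
    using F by (simp add: e_merging_def R_def)
  have coord: "(\<lambda>x. x $ k) \<in> borel_measurable R" for k
    unfolding R_def by (intro measurable_restrict_space1 borel_measurable_continuous_onI)
      (auto intro: continuous_intros)
  have D: "prob_space D"
    unfolding D_def using Q V by (rule prob_space.prob_space_distr)
  have "e_variable D (\<lambda>x. ennreal (x $ k))" for k
    using ev coord[of k] V
    by (auto simp: e_variable_def D_def nn_integral_distr V_def)
  moreover have "\<forall>k. \<forall>x \<in> space D. 0 \<le> x $ k"
    by (auto simp: D_def R_def space_restrict_space nonneg_orthant_def)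
  moreover have "preserves_e_variables D F"
    using F D by (simp add: e_merging_def)
  ultimately have "e_variable D (\<lambda>x. ennreal (F (\<chi> k. x $ k)))"
    unfolding preserves_e_variables_def by (elim allE[where x = "\<lambda>k x. x $ k"]) blast
  then have "e_variable D (\<lambda>x. ennreal (F x))"
    by simp
  then show "e_variable Q (\<lambda>\<omega>. ennreal (F (\<chi> k. E k \<omega>)))"
    using V Fm measurable_compose[OF V Fm]
    by (auto simp: e_variable_def D_def nn_integral_distr V_def)
qed

text \<open>Essential domination is a relation between e-merging functions; the mean is one.\<close>

lemma e_merging_arith_mean: "e_merging (arith_mean :: real ^ 'k \<Rightarrow> real)"
proof -
  have "preserves_e_variables Q (arith_mean :: real ^ 'k \<Rightarrow> real)"
    for Q :: "(real ^ 'k) measure"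
    unfolding preserves_e_variables_def
  proof (intro allI impI, elim conjE)
    fix E :: "'k \<Rightarrow> real ^ 'k \<Rightarrow> real"
    assume nonneg: "\<forall>k. \<forall>\<omega> \<in> space Q. 0 \<le> E k \<omega>"
      and ev: "\<forall>k. e_variable Q (\<lambda>\<omega>. ennreal (E k \<omega>))"
    have Em: "E k \<in> borel_measurable Q" for k
      using e_variable_real_measurable[of Q "E k"] nonneg ev by blast
    have eq: "ennreal (arith_mean (\<chi> k. E k \<omega>)) = ennreal (1 / real CARD('k)) * (\<Sum>k\<in>UNIV. ennreal (E k \<omega>))"
      if "\<omega> \<in> space Q" for \<omega>
      using nonneg that
      by (simp add: arith_mean_def sum_ennreal ennreal_mult[symmetric] sum_nonneg)
    have "(\<integral>\<^sup>+ \<omega>. ennreal (arith_mean (\<chi> k. E k \<omega>)) \<partial>Q)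
        = ennreal (1 / real CARD('k)) * (\<Sum>k\<in>UNIV. \<integral>\<^sup>+ \<omega>. ennreal (E k \<omega>) \<partial>Q)"
      using Em by (subst nn_integral_cong[OF eq]) (auto simp: nn_integral_cmult nn_integral_sum)
    also have "\<dots> \<le> ennreal (1 / real CARD('k)) * (\<Sum>k\<in>(UNIV :: 'k set). 1)"
      using ev by (intro mult_left_mono sum_mono) (auto simp: e_variable_def)
    also have "\<dots> = 1"
      by (simp add: ennreal_of_nat_eq_real_of_nat ennreal_mult[symmetric])
    finally show "e_variable Q (\<lambda>\<omega>. ennreal (arith_mean (\<chi> k. E k \<omega>)))"
      using Em by (auto simp: e_variable_def arith_mean_def)
  qed
  moreover have "arith_mean \<in> borel_measurable (restrict_space (borel :: (real ^ 'k) measure) nonneg_orthant)"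
    unfolding arith_mean_def
    by (intro measurable_restrict_space1 borel_measurable_continuous_onI)
       (auto intro!: continuous_intros)
  ultimately show ?thesis
    by (auto simp: e_merging_def arith_mean_def nonneg_orthant_def less_eq_vec_def
        intro!: mono_onI divide_right_mono sum_mono sum_nonneg divide_nonneg_nonneg)
qed

end

theory Submission imports Defs begin

text \<open>An e-merging function is tested against one randomised vector. Permuting the coordinates of a
  point \<open>e\<close> of the orthant uniformly at random gives every coordinate the expectation
  \<open>a = arith_mean e\<close>, while a symmetric \<open>F\<close> takes the constant value \<open>F e\<close> on the permuted vectors.
  If \<open>a > 1\<close>, the permuted coordinates are not e-variables; they become e-variables when the whole
  vector is replaced by \<open>0\<close> outside an independent event of probability \<open>1 / a\<close>. The choice
  \<open>q = 1 / max 1 a\<close> of this probability covers the case \<open>a \<le> 1\<close> as well: the coordinates have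
  expectation \<open>q * a \<le> 1\<close>, so \<open>F\<close> of the randomised vector has expectation at most \<open>1\<close>. Since
  \<open>F \<ge> 0\<close>, this expectation is at least \<open>q * F e\<close>. Hence \<open>F e \<le> max 1 (arith_mean e)\<close>
  (\<open>symmetric_merging_le_max_one_mean\<close>); where \<open>F e > 1\<close>, the maximum has to be the mean.\<close>

text \<open>Composition with a transposition shows that the sum over permutations is the same for every
  \<open>k\<close>, so it can be averaged over \<open>k\<close>; each single permutation then contributes the full sum of \<open>f\<close>.\<close>

lemma average_over_permutations:
  fixes f :: "'a :: finite \<Rightarrow> real" and k :: 'a
  shows "(\<Sum>p | bij p. f (p k)) / real (card {p :: 'a \<Rightarrow> 'a. bij p})
       = (\<Sum>j\<in>UNIV. f j) / real CARD('a)"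
proof -
  let ?P = "{p :: 'a \<Rightarrow> 'a. bij p}"
  have same: "(\<Sum>p\<in>?P. f (p j)) = (\<Sum>p\<in>?P. f (p k))" for j
    by (rule sum.reindex_bij_witness[of _ "\<lambda>p. p \<circ> Transposition.transpose j k"
          "\<lambda>p. p \<circ> Transposition.transpose j k"])
       (simp_all add: comp_assoc, simp_all add: bij_comp)
  have "real CARD('a) * (\<Sum>p\<in>?P. f (p k)) = (\<Sum>j\<in>UNIV. \<Sum>p\<in>?P. f (p j))"
    by (subst sum.cong[OF refl same]) simp
  also have "\<dots> = (\<Sum>p\<in>?P. \<Sum>j\<in>UNIV. f (p j))"
    by (rule sum.swap)
  also have "\<dots> = (\<Sum>p\<in>?P. \<Sum>j\<in>UNIV. f j)"
    by (intro sum.cong refl sum.reindex_bij_betw) simp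
  also have "\<dots> = real (card ?P) * (\<Sum>j\<in>UNIV. f j)"
    by simp
  finally have eq: "real CARD('a) * (\<Sum>p\<in>?P. f (p k)) = real (card ?P) * (\<Sum>j\<in>UNIV. f j)" .
  have "\<exists>p :: 'a \<Rightarrow> 'a. bij p"
    using bij_id by blast
  then have "real (card ?P) \<noteq> 0" "real CARD('a) \<noteq> 0"
    by simp_all
  with eq show ?thesis
    by (subst frac_eq_eq) (simp_all add: mult.commute)
qed

lemma symmetric_merging_le_max_one_mean:
  fixes F :: "real ^ 'k \<Rightarrow> real"
  assumes F: "e_merging F" and sym: "symmetric_merging F" and e: "e \<in> nonneg_orthant"
  shows "F e \<le> max 1 (arith_mean e)"
proof -
  define a where "a = arith_mean e"
  define q where "q = 1 / max 1 a"
  have q: "0 < q" "q \<le> 1"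
    by (auto simp: q_def)
  have qa: "a * q \<le> 1"
    by (auto simp: q_def divide_le_eq)
  let ?P = "{p :: 'k \<Rightarrow> 'k. bij p}"
  have P: "?P \<noteq> {}" "finite ?P"
    using bij_id by auto
  \<comment> \<open>The Boolean component is the independent event on which the permuted vector is kept.\<close>
  define Q where "Q = measure_pmf (pair_pmf (pmf_of_set ?P) (bernoulli_pmf q))"
  define E where "E = (\<lambda>k (\<omega> :: ('k \<Rightarrow> 'k) \<times> bool). if snd \<omega> then e $ fst \<omega> k else 0)"
  have nonneg: "0 \<le> e $ k" for k
    using e by (simp add: nonneg_orthant_def)
  have F_nonneg: "0 \<le> F x" if "x \<in> nonneg_orthant" for x
    using F that by (simp add: e_merging_def)

  have "(\<integral>\<^sup>+ \<omega>. ennreal (E k \<omega>) \<partial>Q) \<le> 1" for k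
  proof -
    have "(\<integral>\<^sup>+ \<omega>. ennreal (E k \<omega>) \<partial>Q)
        = (\<integral>\<^sup>+ p. ennreal (e $ p k) * ennreal q \<partial>measure_pmf (pmf_of_set ?P))"
      using q by (simp add: Q_def nn_integral_pair_pmf' E_def)
    also have "\<dots> = (\<integral>\<^sup>+ p. ennreal (e $ p k * q) \<partial>measure_pmf (pmf_of_set ?P))"
      using q nonneg by (simp add: ennreal_mult)
    also have "\<dots> = ennreal ((\<Sum>p\<in>?P. e $ p k * q) / real (card ?P))"
      using P q nonneg
      by (simp add: nn_integral_pmf_of_set sum_ennreal divide_ennreal sum_nonneg
          ennreal_of_nat_eq_real_of_nat card_gt_0_iff)
    also have "(\<Sum>p\<in>?P. e $ p k * q) / real (card ?P) = a * q"
      unfolding a_def arith_mean_def average_over_permutations[symmetric, where k = k]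
        sum_distrib_right[symmetric] by simp
    finally show ?thesis
      using qa by simp
  qed
  then have "\<forall>k. e_variable Q (\<lambda>\<omega>. ennreal (E k \<omega>))"
    by (simp add: e_variable_def Q_def)
  moreover have "\<forall>k. \<forall>\<omega> \<in> space Q. 0 \<le> E k \<omega>"
    by (simp add: E_def nonneg)
  moreover have "preserves_e_variables Q F"
    using F by (rule e_merging_any_space) (simp add: Q_def prob_space_measure_pmf)
  ultimately have bound: "(\<integral>\<^sup>+ \<omega>. ennreal (F (\<chi> k. E k \<omega>)) \<partial>Q) \<le> 1"
    unfolding preserves_e_variables_def e_variable_def by blast

  have F_perm: "F (\<chi> k. e $ p k) = F e" if "p \<in> ?P" for p
    using sym e that by (simp add: symmetric_merging_def)
  have "ennreal (F e * q) = (\<integral>\<^sup>+ p. ennreal (F e * q) \<partial>measure_pmf (pmf_of_set ?P))"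
    by simp
  also have "\<dots> = (\<integral>\<^sup>+ p. ennreal (F (\<chi> k. e $ p k)) * ennreal q \<partial>measure_pmf (pmf_of_set ?P))"
    using P q F_perm F_nonneg[OF e]
    by (intro nn_integral_cong_AE) (auto simp: AE_measure_pmf_iff ennreal_mult)
  also have "\<dots> \<le> (\<integral>\<^sup>+ \<omega>. ennreal (F (\<chi> k. E k \<omega>)) \<partial>Q)"
    \<comment> \<open>Outside the event the integrand is \<open>F\<close> at the origin; dropping it only decreases the integral.\<close>
    using q by (auto simp: Q_def nn_integral_pair_pmf' E_def intro!: nn_integral_mono)
  also note bound
  finally have "F e * q \<le> 1"
    by simp
  moreover have "F e * q = F e / max 1 a" and "0 < max 1 a"
    by (simp_all add: q_def)
  ultimately have "F e \<le> 1 * max 1 a"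
    by (simp add: pos_divide_le_eq)
  then show ?thesis
    by (simp add: a_def)
qed

theorem proposition3p1:
  fixes F :: "real ^ 'k \<Rightarrow> real"
  assumes "CARD('k) \<ge> 2"
    and "e_merging F"
    and "symmetric_merging F"
  shows "essentially_dominates (arith_mean :: real ^ 'k \<Rightarrow> real) F"
  using symmetric_merging_le_max_one_mean[OF assms(2,3)]
  unfolding essentially_dominates_def by (meson le_max_iff_disj not_le)

end
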